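(* Any game of Infinite Hex with defined game value for some player is essentially local for that player; thus, it has finite game value for that player.
   Context: Infinite Hex board. Cells are the pairs $(a,j)$ with $j\in\mathbb{Z}$ and $a\in\mathbb{Z}+j/2$ ($a$ is the West–East position of the cell's centre, $j$ its South–North row), two cells $(a,j),(a',j')$ being adjacent iff either $j=j'$ and $|a-a'|=1$, or $|j-j'|=1$ and $|a-a'|=1/2$ (the hexagonal tiling of the plane with horizontal rows). A board configuration marks each cell as empty, Red or Blue. A Red (resp. Blue) $\mathbb{Z}$-chain is a map $r:\mathbb{Z}\to$ cells such that every $r(n)$ is Red (resp. Blue) and $r(n),r(n+1)$ are adjacent for all $n$. For a cell $h_0=(a_0,j_0)$, a Red chain $r$ is winning with respect to $h_0$ if there is $M$ such that for all $m\ge M$: $r(m)=(a,j)$ has $a>a_0$, $j>j_0$, and $r(-m)=(a,j)$ has $a<a_0$, $j<j_0$ (eventually in the NE resp. SW quadrant). A Blue chain $b$ is winning with respect to $h_0$ if eventually $b(m)$ has $a<a_0,j>j_0$ and $b(-m)$ has $a>a_0,j<j_0$ (NW resp. SE). A chain is winning if it is winning with respect to every cell $h_0$. A game of Infinite Hex is given by an initial configuration (possibly with infinitely many marked cells) and a player to move; Red and Blue alternately mark one empty cell with their own colour; a player wins as soon as his marked cells contain a winning chain of his colour. Game values: for a player $P$ with opponent $Q$, positions get values recursively: a position at which $P$ has already won has value $0$; if $P$ is to move and $\alpha$ is the least value among successors having a value, the value is $\alpha+1$; if $Q$ is to move and every successor has a value, the value is the supremum; otherwise undefined. The game value is the value of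 the initial position. Dead regions and locality: if the game has defined value $\alpha$ for $P$, a dead region for $Q$ is a set $R$ of cells such that assigning all empty cells of $R$ to $Q$ yields (with the same player to move) a game still of value $\alpha$ for $P$. The game is essentially local for $P$ if some set of cells containing all but finitely many of the initially empty cells is a dead region for $Q$. *)

theory Defs
  imports Complex_Main "HOL-Library.Countable_Set"
begin

section \<open>Ordinals\<close>

text \<open>
  The values of Infinite Hex positions are countable ordinals, since a position has only
  countably many successors.  The type below is the first uncountable ordinal, i.e. the
  well-ordered set of all countable ordinals; \<open>ordinal_lt_osuc\<close> and \<open>ordinal_osup_upper\<close>
  show that successors and countable suprema are never cut off.
\<close>

typedef ordinal = "Field (cardSuc natLeq)"
proof -
  have "\<not> finite (Field (cardSuc natLeq))"
    using cardSuc_finite[OF natLeq_Card_order] by (simp add: Field_natLeq)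
  then show ?thesis by (metis ex_in_conv finite.emptyI)
qed

setup_lifting type_definition_ordinal

lemma cardSuc_natLeq_Well_order: "Well_order (cardSuc natLeq)"
  using cardSuc_Card_order[OF natLeq_Card_order] by (simp add: card_order_on_def)

lemma cardSuc_natLeq_infinite: "\<not> finite (Field (cardSuc natLeq))"
  using cardSuc_finite[OF natLeq_Card_order] by (simp add: Field_natLeq)

instantiation ordinal :: wellorder
begin

lift_definition less_eq_ordinal :: "ordinal \<Rightarrow> ordinal \<Rightarrow> bool"
  is "\<lambda>x y. (x, y) \<in> cardSuc natLeq" .

definition less_ordinal :: "ordinal \<Rightarrow> ordinal \<Rightarrow> bool" where
  "less_ordinal x y \<longleftrightarrow> x \<le> y \<and> \<not> y \<le> x"

instance
proof
  let ?r = "cardSuc natLeq"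
  have rf: "refl_on (Field ?r) ?r" and tr: "trans ?r" and as: "antisym ?r"
    and tot: "total_on (Field ?r) ?r"
    using cardSuc_natLeq_Well_order by (simp_all add: order_on_defs)
  note le = less_eq_ordinal.rep_eq
  fix x y z :: ordinal
  show "x < y \<longleftrightarrow> x \<le> y \<and> \<not> y \<le> x" by (fact less_ordinal_def)
  show refl: "x \<le> x"
    unfolding le using refl_onD[OF rf Rep_ordinal] .
  show "x \<le> z" if "x \<le> y" "y \<le> z"
    using transD[OF tr] that unfolding le by blast
  show "x = y" if "x \<le> y" "y \<le> x"
    using antisymD[OF as] that unfolding le by (metis Rep_ordinal_inject)
  show "x \<le> y \<or> y \<le> x"
  proof (cases "x = y")
    case True
    then show ?thesis using refl by simp
  next
    case False
    then have "Rep_ordinal x \<noteq> Rep_ordinal y" by (simp add: Rep_ordinal_inject)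
    then show ?thesis
      unfolding le using tot Rep_ordinal[of x] Rep_ordinal[of y] unfolding total_on_def by blast
  qed
next
  fix P :: "ordinal \<Rightarrow> bool" and a :: ordinal
  assume step: "\<And>x. (\<And>y. y < x \<Longrightarrow> P y) \<Longrightarrow> P x"
  have wfr: "wf (cardSuc natLeq - Id)"
    using cardSuc_natLeq_Well_order by (simp add: well_order_on_def)
  have "wf {(x, y). x < (y :: ordinal)}"
  proof (rule wf_subset[OF wf_inv_image[OF wfr, of Rep_ordinal]], rule subrelI)
    fix x y :: ordinal
    assume "(x, y) \<in> {(x, y). x < y}"
    then show "(x, y) \<in> inv_image (cardSuc natLeq - Id) Rep_ordinal"
      by (auto simp: less_ordinal_def less_eq_ordinal.rep_eq)
  qed
  then show "P a"
    by (induction a rule: wf_induct_rule) (use step in auto)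
qed

end

instantiation ordinal :: zero
begin
definition zero_ordinal :: ordinal where "0 = (LEAST x :: ordinal. True)"
instance ..
end

definition osuc :: "ordinal \<Rightarrow> ordinal" where
  "osuc x = (LEAST y. x < y)"

definition osup :: "ordinal set \<Rightarrow> ordinal" where
  "osup A = (LEAST u. \<forall>x\<in>A. x \<le> u)"

definition finite_ordinal :: "ordinal \<Rightarrow> bool" where
  "finite_ordinal x \<longleftrightarrow> (\<exists>n::nat. x = (osuc ^^ n) 0)"

lemma ordinal_zero_le [simp]: "0 \<le> (x :: ordinal)"
  by (simp add: zero_ordinal_def Least_le)

lemma ordinal_lt_osuc: "x < osuc x"
proof -
  obtain b where b: "b \<in> Field (cardSuc natLeq)" "Rep_ordinal x \<noteq> b"
      "(Rep_ordinal x, b) \<in> cardSuc natLeq"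
    using infinite_Card_order_limit[OF cardSuc_Card_order[OF natLeq_Card_order]
        cardSuc_natLeq_infinite Rep_ordinal[of x]] by blast
  have "x \<le> Abs_ordinal b" "x \<noteq> Abs_ordinal b"
    using b by (auto simp: less_eq_ordinal.rep_eq Abs_ordinal_inverse)
  then have "x < Abs_ordinal b" by simp
  then show ?thesis unfolding osuc_def by (rule LeastI)
qed

lemma ordinal_osuc_le_iff: "osuc x \<le> y \<longleftrightarrow> x < y"
  using ordinal_lt_osuc[of x] by (auto simp: osuc_def intro: Least_le)

lemma ordinal_countable_bounded:
  includes cardinal_syntax
  assumes "countable (A :: ordinal set)"
  shows "\<exists>u. \<forall>x\<in>A. x \<le> u"
proof -
  let ?r = "cardSuc natLeq"
  have tr: "trans ?r" and rf: "refl_on (Field ?r) ?r"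
    using cardSuc_natLeq_Well_order by (simp_all add: order_on_defs)
  have "|Rep_ordinal ` A| \<le>o |UNIV :: nat set|"
    using countable_image[OF assms, of Rep_ordinal]
    by (auto simp: countable_def card_of_ordLeq[symmetric])
  then have card: "|Rep_ordinal ` A| \<le>o natLeq"
    using card_of_nat ordLeq_ordIso_trans by blast
  have "relChain ?r (under ?r)"
    using tr unfolding relChain_def under_def trans_def by blast
  moreover have "Rep_ordinal ` A \<subseteq> (\<Union>i\<in>Field ?r. under ?r i)"
    using rf Rep_ordinal unfolding under_def refl_on_def by blast
  ultimately obtain i where "i \<in> Field ?r" "Rep_ordinal ` A \<subseteq> under ?r i"
    using cardSuc_UNION[OF natLeq_Card_order _ _ _ card, of "under ?r"]
    by (auto simp: Field_natLeq)
  then have "\<forall>x\<in>A. x \<le> Abs_ordinal i"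
    by (auto simp: less_eq_ordinal.rep_eq Abs_ordinal_inverse under_def)
  then show ?thesis ..
qed

lemma ordinal_osup_upper:
  assumes "countable A" "x \<in> A"
  shows "x \<le> osup A"
  using LeastI_ex[OF ordinal_countable_bounded[OF assms(1)]] assms(2)
  by (auto simp: osup_def)

lemma ordinal_osup_least:
  assumes "\<And>x. x \<in> A \<Longrightarrow> x \<le> u"
  shows "osup A \<le> u"
  unfolding osup_def using assms by (auto intro: Least_le)


section \<open>The board\<close>

typedef cell = "{(a :: rat, j :: int). a - of_int j / 2 \<in> \<int>}"
  by (rule exI[of _ "(0, 0)"]) simp

definition we_pos :: "cell \<Rightarrow> rat" where
  "we_pos h = fst (Rep_cell h)"

definition row :: "cell \<Rightarrow> int" where
  "row h = snd (Rep_cell h)"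

definition adjacent :: "cell \<Rightarrow> cell \<Rightarrow> bool" where
  "adjacent h h' \<longleftrightarrow>
     row h = row h' \<and> \<bar>we_pos h - we_pos h'\<bar> = 1 \<or>
     \<bar>row h - row h'\<bar> = 1 \<and> \<bar>we_pos h - we_pos h'\<bar> = 1 / 2"

datatype player = Red | Blue

fun opponent :: "player \<Rightarrow> player" where
  "opponent Red = Blue"
| "opponent Blue = Red"

type_synonym config = "cell \<Rightarrow> player option"

definition Z_chain :: "player \<Rightarrow> config \<Rightarrow> (int \<Rightarrow> cell) \<Rightarrow> bool" where
  "Z_chain p c r \<longleftrightarrow> (\<forall>n. c (r n) = Some p) \<and> (\<forall>n. adjacent (r n) (r (n + 1)))"

fun winning_wrt :: "player \<Rightarrow> cell \<Rightarrow> (int \<Rightarrow> cell) \<Rightarrow> bool" where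
  "winning_wrt Red h0 r \<longleftrightarrow>
     (\<exists>M. \<forall>m\<ge>M. we_pos (r m) > we_pos h0 \<and> row (r m) > row h0 \<and>
                we_pos (r (- m)) < we_pos h0 \<and> row (r (- m)) < row h0)"
| "winning_wrt Blue h0 r \<longleftrightarrow>
     (\<exists>M. \<forall>m\<ge>M. we_pos (r m) < we_pos h0 \<and> row (r m) > row h0 \<and>
                we_pos (r (- m)) > we_pos h0 \<and> row (r (- m)) < row h0)"

definition has_won :: "player \<Rightarrow> config \<Rightarrow> bool" where
  "has_won p c \<longleftrightarrow> (\<exists>r. Z_chain p c r \<and> (\<forall>h0. winning_wrt p h0 r))"


section \<open>The game and its values\<close>

text \<open>A game is given by its initial position.\<close>

record position =
  board :: config
  to_move :: player

definition empty_cells :: "position \<Rightarrow> cell set" where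
  "empty_cells s = {h. board s h = None}"

definition successors :: "position \<Rightarrow> position set" where
  "successors s =
     (if \<exists>p. has_won p (board s) then {}
      else {\<lparr>board = (board s)(h := Some (to_move s)), to_move = opponent (to_move s)\<rparr> |h.
              h \<in> empty_cells s})"

text \<open>
  \<open>V\<close> assigns values for \<open>p\<close> recursively.  A position without successors which \<open>p\<close>
  has not won is a lost or drawn final position; hence the condition
  \<open>successors s \<noteq> {}\<close> in the last case, without which such positions with
  the opponent to move would vacuously get the value \<open>osup {} = 0\<close>.
\<close>

definition valuation :: "player \<Rightarrow> (position \<Rightarrow> ordinal option) \<Rightarrow> bool" where
  "valuation p V \<longleftrightarrow> (\<forall>s. V s =
     (let vals = {\<alpha>. \<exists>t\<in>successors s. V t = Some \<alpha>} in
      if has_won p (board s) then Some 0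
      else if to_move s = p then
        (if vals \<noteq> {} then Some (osuc (LEAST \<alpha>. \<alpha> \<in> vals)) else None)
      else
        (if successors s \<noteq> {} \<and> (\<forall>t\<in>successors s. V t \<noteq> None) then Some (osup vals)
         else None)))"

text \<open>Well defined by \<open>valuation_unique_exists\<close> below.\<close>

definition game_value :: "player \<Rightarrow> position \<Rightarrow> ordinal option" where
  "game_value p = (THE V. valuation p V)"

lemma valuationD:
  assumes "valuation p V"
  shows "has_won p (board s) \<Longrightarrow> V s = Some 0"
    and "\<not> has_won p (board s) \<Longrightarrow> to_move s = p \<Longrightarrow>
      V s = (if \<exists>t\<in>successors s. V t \<noteq> None
             then Some (osuc (LEAST \<alpha>. \<exists>t\<in>successors s. V t = Some \<alpha>)) else None)"
    and "\<not> has_won p (board s) \<Longrightarrow> to_move s \<noteq> p \<Longrightarrow>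
      V s = (if successors s \<noteq> {} \<and> (\<forall>t\<in>successors s. V t \<noteq> None)
             then Some (osup {\<alpha>. \<exists>t\<in>successors s. V t = Some \<alpha>}) else None)"
  using assms unfolding valuation_def Let_def
  by (auto split: if_splits)

lemma opponent_neq: "p \<noteq> q \<Longrightarrow> opponent p = q"
  by (cases p; cases q) auto

lemma successors_to_move: "t \<in> successors s \<Longrightarrow> to_move t = opponent (to_move s)"
  by (auto simp: successors_def split: if_splits)

instance cell :: countable
proof
  have "inj (to_nat \<circ> Rep_cell)"
    by (auto simp: inj_def Rep_cell_inject)
  then show "\<exists>f :: cell \<Rightarrow> nat. inj f" by blast
qed

lemma countable_successors: "countable (successors s)"
proof -
  have "successors s \<subseteq> range (\<lambda>h. \<lparr>board = (board s)(h := Some (to_move s)),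
      to_move = opponent (to_move s)\<rparr>)"
    by (auto simp: successors_def)
  then show ?thesis by (rule countable_subset) simp
qed

lemma countable_successor_values:
  "countable {\<alpha>. \<exists>t\<in>successors s. V t = Some (\<alpha> :: ordinal)}"
proof -
  have "{\<alpha>. \<exists>t\<in>successors s. V t = Some \<alpha>} \<subseteq> (\<lambda>t. the (V t)) ` successors s"
    by force
  then show ?thesis
    by (rule countable_subset) (simp add: countable_successors)
qed

function has_value :: "player \<Rightarrow> ordinal \<Rightarrow> position \<Rightarrow> bool" where
  "has_value p \<alpha> s \<longleftrightarrow>
     (if has_won p (board s) then \<alpha> = 0
      else if to_move s = p then
        (\<exists>\<beta>\<in>{..<\<alpha>}. \<alpha> = osuc \<beta> \<and> (\<exists>t\<in>successors s. has_value p \<beta> t) \<and>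
           (\<forall>\<gamma>\<in>{..<\<beta>}. \<forall>t\<in>successors s. \<not> has_value p \<gamma> t))
      else successors s \<noteq> {} \<and> (\<forall>t\<in>successors s. \<exists>\<beta>\<in>{..\<alpha>}. has_value p \<beta> t) \<and>
        (\<forall>\<gamma>\<in>{..<\<alpha>}. \<exists>t\<in>successors s. \<exists>\<beta>\<in>{..\<alpha>}. \<gamma> < \<beta> \<and> has_value p \<beta> t))"
  by pat_completeness auto
termination
  apply (relation "inv_image ({(x, y). x < y} <*lex*> less_than)
    (\<lambda>(p, \<alpha>, s). (\<alpha>, if to_move s = p then 0 else 1))")
  apply (auto simp: wf dest: successors_to_move opponent_neq)
  done

declare has_value.simps [simp del]

lemma has_value_won: "has_won p (board s) \<Longrightarrow> has_value p \<alpha> s \<longleftrightarrow> \<alpha> = 0"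
  by (simp add: has_value.simps[of p \<alpha> s])

lemma has_value_own:
  "\<not> has_won p (board s) \<Longrightarrow> to_move s = p \<Longrightarrow> has_value p \<alpha> s \<longleftrightarrow>
     (\<exists>\<beta><\<alpha>. \<alpha> = osuc \<beta> \<and> (\<exists>t\<in>successors s. has_value p \<beta> t) \<and>
        (\<forall>\<gamma><\<beta>. \<forall>t\<in>successors s. \<not> has_value p \<gamma> t))"
  unfolding has_value.simps[of p \<alpha> s] by (simp add: Bex_def Ball_def)

lemma has_value_opp:
  "\<not> has_won p (board s) \<Longrightarrow> to_move s \<noteq> p \<Longrightarrow> has_value p \<alpha> s \<longleftrightarrow>
     successors s \<noteq> {} \<and> (\<forall>t\<in>successors s. \<exists>\<beta>\<le>\<alpha>. has_value p \<beta> t) \<and>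
     (\<forall>\<gamma><\<alpha>. \<exists>t\<in>successors s. \<exists>\<beta>\<le>\<alpha>. \<gamma> < \<beta> \<and> has_value p \<beta> t)"
  unfolding has_value.simps[of p \<alpha> s] by (simp add: Bex_def Ball_def)

lemma has_value_unique_own:
  assumes "has_value p \<alpha> s" "has_value p \<beta> s" "has_won p (board s) \<or> to_move s = p"
  shows "\<alpha> = \<beta>"
proof (cases "has_won p (board s)")
  case True
  then show ?thesis using assms by (simp add: has_value_won)
next
  case False
  with assms obtain a b where
      a: "\<alpha> = osuc a" "\<exists>t\<in>successors s. has_value p a t"
        "\<forall>\<gamma><a. \<forall>t\<in>successors s. \<not> has_value p \<gamma> t"
    and b: "\<beta> = osuc b" "\<exists>t\<in>successors s. has_value p b t"
        "\<forall>\<gamma><b. \<forall>t\<in>successors s. \<not> has_value p \<gamma> t"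
    by (auto simp: has_value_own)
  then have "a = b" by (metis linorder_less_linear)
  with a b show ?thesis by simp
qed

lemma has_value_unique:
  assumes "has_value p \<alpha> s" "has_value p \<beta> s"
  shows "\<alpha> = \<beta>"
proof (cases "has_won p (board s) \<or> to_move s = p")
  case True
  then show ?thesis using assms has_value_unique_own by blast
next
  case False
  have no: "\<not> x < y" if x: "has_value p x s" and y: "has_value p y s" for x y
  proof
    assume "x < y"
    moreover have "\<forall>\<gamma><y. \<exists>t\<in>successors s. \<exists>\<beta>\<le>y. \<gamma> < \<beta> \<and> has_value p \<beta> t"
      using y False by (simp add: has_value_opp)
    ultimately obtain t z where t: "t \<in> successors s" "x < z" "has_value p z t"
      by blast
    with x False obtain w where w: "w \<le> x" "has_value p w t"
      by (auto simp: has_value_opp)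
    have "to_move t = p" using successors_to_move[OF t(1)] False opponent_neq by auto
    then have "w = z" using has_value_unique_own w(2) t(3) by blast
    with w t show False by simp
  qed
  show ?thesis using no assms linorder_less_linear by blast
qed

lemma valuation_iff_has_value_own:
  assumes V: "valuation p V" and s: "has_won p (board s) \<or> to_move s = p"
    and IH: "\<And>\<beta> t. \<beta> < \<alpha> \<Longrightarrow> V t = Some \<beta> \<longleftrightarrow> has_value p \<beta> t"
  shows "V s = Some \<alpha> \<longleftrightarrow> has_value p \<alpha> s"
proof (cases "has_won p (board s)")
  case True
  then show ?thesis using valuationD(1)[OF V] by (auto simp: has_value_won)
next
  case False
  then have own: "to_move s = p" using s by blast
  define Q where "Q \<beta> \<longleftrightarrow> (\<exists>t\<in>successors s. V t = Some \<beta>)" for \<beta>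
  have Vs: "V s = (if \<exists>\<beta>. Q \<beta> then Some (osuc (LEAST \<beta>. Q \<beta>)) else None)"
    unfolding Q_def using valuationD(2)[OF V False own] by auto
  have Q: "Q \<beta> \<longleftrightarrow> (\<exists>t\<in>successors s. has_value p \<beta> t)" if "\<beta> < \<alpha>" for \<beta>
    unfolding Q_def using IH[OF that] by blast
  have "V s = Some \<alpha> \<longleftrightarrow> (\<exists>\<beta><\<alpha>. \<alpha> = osuc \<beta> \<and> Q \<beta> \<and> (\<forall>\<gamma><\<beta>. \<not> Q \<gamma>))"
  proof
    assume "V s = Some \<alpha>"
    then have "\<exists>\<beta>. Q \<beta>" "\<alpha> = osuc (LEAST \<beta>. Q \<beta>)"
      using Vs by (auto split: if_splits)
    then show "\<exists>\<beta><\<alpha>. \<alpha> = osuc \<beta> \<and> Q \<beta> \<and> (\<forall>\<gamma><\<beta>. \<not> Q \<gamma>)"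
      using LeastI_ex[of Q] not_less_Least[of _ Q] ordinal_lt_osuc by blast
  next
    assume "\<exists>\<beta><\<alpha>. \<alpha> = osuc \<beta> \<and> Q \<beta> \<and> (\<forall>\<gamma><\<beta>. \<not> Q \<gamma>)"
    then obtain \<beta> where b: "\<alpha> = osuc \<beta>" "Q \<beta>" "\<forall>\<gamma><\<beta>. \<not> Q \<gamma>" by blast
    then have "(LEAST \<beta>. Q \<beta>) = \<beta>"
      by (intro Least_equality) (auto intro: leI)
    then show "V s = Some \<alpha>" using Vs b by auto
  qed
  also have "\<dots> \<longleftrightarrow> has_value p \<alpha> s"
  proof -
    have "Q \<beta> \<and> (\<forall>\<gamma><\<beta>. \<not> Q \<gamma>) \<longleftrightarrow> (\<exists>t\<in>successors s. has_value p \<beta> t) \<and>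
        (\<forall>\<gamma><\<beta>. \<forall>t\<in>successors s. \<not> has_value p \<gamma> t)" if "\<beta> < \<alpha>" for \<beta>
      using Q that less_trans[OF _ that] by auto
    then show ?thesis unfolding has_value_own[OF False own] by blast
  qed
  finally show ?thesis .
qed

lemma valuation_iff_has_value:
  assumes V: "valuation p V"
  shows "V s = Some \<alpha> \<longleftrightarrow> has_value p \<alpha> s"
proof (induction \<alpha> arbitrary: s rule: less_induct)
  case (less \<alpha>)
  note own = valuation_iff_has_value_own[OF V _ less]
  show ?case
  proof (cases "has_won p (board s) \<or> to_move s = p")
    case True
    then show ?thesis using own by blast
  next
    case False
    then have nw: "\<not> has_won p (board s)" and op: "to_move s \<noteq> p" by auto
    have t: "V t = Some \<beta> \<longleftrightarrow> has_value p \<beta> t" if "t \<in> successors s" "\<beta> \<le> \<alpha>" for t \<beta>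
    proof (cases "\<beta> < \<alpha>")
      case True
      then show ?thesis by (rule less)
    next
      case False
      then have "\<beta> = \<alpha>" using that by simp
      moreover have "to_move t = p"
        using successors_to_move[OF that(1)] op opponent_neq by auto
      ultimately show ?thesis using own by blast
    qed
    let ?A = "{\<alpha>. \<exists>t\<in>successors s. V t = Some \<alpha>}"
    have Vs: "V s = (if successors s \<noteq> {} \<and> (\<forall>t\<in>successors s. V t \<noteq> None)
                     then Some (osup ?A) else None)"
      by (rule valuationD(3)[OF V nw op])
    show ?thesis
    proof
      assume "V s = Some \<alpha>"
      then have ne: "successors s \<noteq> {}" and all: "\<forall>t\<in>successors s. V t \<noteq> None"
        and \<alpha>: "\<alpha> = osup ?A"
        using Vs by (auto split: if_splits)
      have le: "\<beta> \<le> \<alpha>" if "t \<in> successors s" "V t = Some \<beta>" for t \<beta>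
        using ordinal_osup_upper[OF countable_successor_values[of s V], of \<beta>] that \<alpha> by blast
      have 1: "\<exists>\<beta>\<le>\<alpha>. has_value p \<beta> t" if "t \<in> successors s" for t
        using all that le t by blast
      have 2: "\<exists>t\<in>successors s. \<exists>\<beta>\<le>\<alpha>. \<gamma> < \<beta> \<and> has_value p \<beta> t" if g: "\<gamma> < \<alpha>" for \<gamma>
      proof (rule ccontr)
        assume "\<not> ?thesis"
        then have none: "\<not> (\<exists>t\<in>successors s. \<exists>\<beta>\<le>\<alpha>. \<gamma> < \<beta> \<and> has_value p \<beta> t)" .
        have "\<beta> \<le> \<gamma>" if "\<beta> \<in> ?A" for \<beta>
        proof -
          from that obtain t' where t': "t' \<in> successors s" "V t' = Some \<beta>" by blast
          then have "\<beta> \<le> \<alpha>" "has_value p \<beta> t'" using le t by blast+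
          with none t'(1) show ?thesis by (meson not_less)
        qed
        then have "osup ?A \<le> \<gamma>" by (rule ordinal_osup_least)
        with g \<alpha> show False by simp
      qed
      show "has_value p \<alpha> s"
        using ne 1 2 by (simp add: has_value_opp[OF nw op])
    next
      assume "has_value p \<alpha> s"
      then have ne: "successors s \<noteq> {}"
        and 1: "\<And>t. t \<in> successors s \<Longrightarrow> \<exists>\<beta>\<le>\<alpha>. V t = Some \<beta>"
        and 2: "\<And>\<gamma>. \<gamma> < \<alpha> \<Longrightarrow> \<exists>t\<in>successors s. \<exists>\<beta>\<le>\<alpha>. \<gamma> < \<beta> \<and> V t = Some \<beta>"
        using t by (simp_all add: has_value_opp[OF nw op]) blast+
      have "osup ?A \<le> \<alpha>"
      proof (rule ordinal_osup_least)
        fix x assume "x \<in> ?A"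
        then obtain t' where t': "t' \<in> successors s" "V t' = Some x" by blast
        with 1[OF t'(1)] show "x \<le> \<alpha>" by auto
      qed
      moreover have "\<not> osup ?A < \<alpha>"
      proof
        assume "osup ?A < \<alpha>"
        from 2[OF this] obtain \<beta> where "osup ?A < \<beta>" "\<beta> \<in> ?A" by blast
        with ordinal_osup_upper[OF countable_successor_values[of s V], of \<beta>]
        show False by simp
      qed
      ultimately have "osup ?A = \<alpha>" by simp
      moreover have "\<forall>t\<in>successors s. V t \<noteq> None"
      proof
        fix t' assume "t' \<in> successors s"
        from 1[OF this] show "V t' \<noteq> None" by auto
      qed
      ultimately show "V s = Some \<alpha>" using Vs ne by simp
    qed
  qed
qed

lemma valuation_exists: "\<exists>V. valuation p V"
proof -
  define V where "V s = (if \<exists>\<alpha>. has_value p \<alpha> s then Some (THE \<alpha>. has_value p \<alpha> s) else None)"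
    for s
  have V: "V s = Some \<alpha> \<longleftrightarrow> has_value p \<alpha> s" for s \<alpha>
  proof (cases "\<exists>\<beta>. has_value p \<beta> s")
    case True
    then obtain \<beta> where b: "has_value p \<beta> s" by blast
    then have "(THE \<alpha>. has_value p \<alpha> s) = \<beta>"
      by (rule the_equality) (rule has_value_unique[OF _ b])
    then have "V s = Some \<beta>" using True by (simp add: V_def)
    then have "V s = Some \<alpha> \<longleftrightarrow> \<alpha> = \<beta>" by auto
    then show ?thesis using b has_value_unique[OF b, of \<alpha>] by blast
  next
    case False
    then show ?thesis by (simp add: V_def)
  qed
  have "V s =
     (let vals = {\<alpha>. \<exists>t\<in>successors s. V t = Some \<alpha>} in
      if has_won p (board s) then Some 0
      else if to_move s = p then
        (if vals \<noteq> {} then Some (osuc (LEAST \<alpha>. \<alpha> \<in> vals)) else None)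
      else
        (if successors s \<noteq> {} \<and> (\<forall>t\<in>successors s. V t \<noteq> None) then Some (osup vals)
         else None))" for s
  proof -
    let ?A = "{\<alpha>. \<exists>t\<in>successors s. V t = Some \<alpha>}"
    consider (w) "has_won p (board s)"
      | (own) "\<not> has_won p (board s)" "to_move s = p"
      | (opp) "\<not> has_won p (board s)" "to_move s \<noteq> p" by blast
    then show ?thesis
    proof cases
      case w
      then have "V s = Some 0" by (simp add: V has_value_won)
      with w show ?thesis by simp
    next
      case own
      have "V s = (if ?A \<noteq> {} then Some (osuc (LEAST \<alpha>. \<alpha> \<in> ?A)) else None)"
      proof (cases "?A = {}")
        case True
        then have "\<not> has_value p \<alpha> s" for \<alpha>
          by (auto simp: has_value_own[OF own] V)
        then have "V s = None" by (simp add: V_def)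
        with True show ?thesis by simp
      next
        case False
        define b where "b = (LEAST \<alpha>. \<alpha> \<in> ?A)"
        obtain a where "a \<in> ?A" using False by blast
        then have bA: "b \<in> ?A" unfolding b_def by (rule LeastI)
        have nA: "\<gamma> \<notin> ?A" if "\<gamma> < b" for \<gamma>
          using that unfolding b_def by (rule not_less_Least)
        have "\<exists>t\<in>successors s. has_value p b t"
          using bA unfolding V by (rule CollectD)
        moreover have "\<forall>\<gamma><b. \<forall>t\<in>successors s. \<not> has_value p \<gamma> t"
          using nA unfolding V by blast
        ultimately have "has_value p (osuc b) s"
          unfolding has_value_own[OF own] using ordinal_lt_osuc[of b] by blast
        then have "V s = Some (osuc b)" unfolding V .
        then show ?thesis using False by (simp only: b_def if_True not_False_eq_True)
      qed
      with own show ?thesis by (simp add: Let_def)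
    next
      case opp
      have "V s = (if successors s \<noteq> {} \<and> (\<forall>t\<in>successors s. V t \<noteq> None)
                   then Some (osup ?A) else None)"
      proof (cases "successors s \<noteq> {} \<and> (\<forall>t\<in>successors s. V t \<noteq> None)")
        case False
        have "\<not> has_value p \<alpha> s" for \<alpha>
        proof
          assume "has_value p \<alpha> s"
          then have "successors s \<noteq> {}" "\<forall>t\<in>successors s. \<exists>\<beta>. has_value p \<beta> t"
            unfolding has_value_opp[OF opp] by blast+
          moreover from this(2) have "\<forall>t\<in>successors s. V t \<noteq> None"
            using V by (metis option.distinct(1))
          ultimately show False using False by blast
        qed
        then have "V s = None" by (simp add: V_def)
        with False show ?thesis by simp
      next
        case True
        have up: "\<beta> \<le> osup ?A" if "t \<in> successors s" "has_value p \<beta> t" for t \<beta>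
          by (rule ordinal_osup_upper[OF countable_successor_values[of s V]])
            (use that V in blast)
        have 2: "\<exists>t\<in>successors s. \<exists>\<beta>\<le>osup ?A. \<gamma> < \<beta> \<and> has_value p \<beta> t"
          if g: "\<gamma> < osup ?A" for \<gamma>
        proof (rule ccontr)
          assume "\<not> ?thesis"
          then have none:
            "\<not> (\<exists>t\<in>successors s. \<exists>\<beta>\<le>osup ?A. \<gamma> < \<beta> \<and> has_value p \<beta> t)" .
          have "\<beta> \<le> \<gamma>" if "\<beta> \<in> ?A" for \<beta>
          proof (rule ccontr)
            assume "\<not> \<beta> \<le> \<gamma>"
            then have lt: "\<gamma> < \<beta>" by (rule not_le_imp_less)
            from that obtain t' where "t' \<in> successors s" "V t' = Some \<beta>" by blast
            then have t': "t' \<in> successors s" "has_value p \<beta> t'" unfolding V .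
            with none up[OF t'] lt show False by blast
          qed
          then have "osup ?A \<le> \<gamma>" by (rule ordinal_osup_least)
          with g show False by simp
        qed
        have 1: "\<exists>\<beta>\<le>osup ?A. has_value p \<beta> t" if t: "t \<in> successors s" for t
        proof -
          obtain \<beta> where "V t = Some \<beta>" using True t by blast
          then have "has_value p \<beta> t" unfolding V .
          with up[OF t this] show ?thesis by blast
        qed
        have "has_value p (osup ?A) s"
          unfolding has_value_opp[OF opp] using True 1 2 by (intro conjI ballI allI impI) simp_all
        then have "V s = Some (osup ?A)" unfolding V .
        then show ?thesis using True by simp
      qed
      with opp show ?thesis by (simp add: Let_def)
    qed
  qed
  then have "valuation p V" unfolding valuation_def by (rule allI)
  then show ?thesis by (rule exI[of _ V])
qed

theorem valuation_unique_exists: "\<exists>!V. valuation p V"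
proof -
  have "V = V'" if "valuation p V" "valuation p V'" for V V'
  proof
    fix s
    show "V s = V' s"
      using valuation_iff_has_value[OF that(1), of s] valuation_iff_has_value[OF that(2), of s]
      by (cases "V s"; cases "V' s") auto
  qed
  then show ?thesis using valuation_exists by blast
qed

theorem valuation_game_value: "valuation p (game_value p)"
  unfolding game_value_def by (rule theI'[OF valuation_unique_exists])


section \<open>Dead regions and locality\<close>

definition assign_region :: "player \<Rightarrow> cell set \<Rightarrow> position \<Rightarrow> position" where
  "assign_region q R s =
     s\<lparr>board := (\<lambda>h. if h \<in> R \<and> h \<in> empty_cells s then Some q else board s h)\<rparr>"

text \<open>Dead for the opponent of \<open>p\<close>, with respect to the value for \<open>p\<close>.\<close>

definition dead_region :: "player \<Rightarrow> position \<Rightarrow> cell set \<Rightarrow> bool" where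
  "dead_region p s R \<longleftrightarrow>
     (\<exists>\<alpha>. game_value p s = Some \<alpha> \<and>
          game_value p (assign_region (opponent p) R s) = Some \<alpha>)"

definition essentially_local :: "player \<Rightarrow> position \<Rightarrow> bool" where
  "essentially_local p s \<longleftrightarrow> (\<exists>R. finite (empty_cells s - R) \<and> dead_region p s R)"

end

theory Submission
  imports Defs
begin

text \<open>
  If \<open>p\<close> wins from a position, then he already wins when all but finitely many empty cells are
  given to the opponent \<open>q\<close>; this goes by induction on the value.  The crucial case is \<open>q\<close> to
  move: pick one arbitrary move \<open>h0\<close> of \<open>q\<close>.  By induction, \<open>p\<close>'s answer only needs a finite set
  \<open>F0\<close>, so the same answer works against every move outside \<open>F0\<close>, and only the finitely many
  moves inside \<open>F0\<close>, each answered within a finite set, remain.  Hence the supremum over all moves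
  is a maximum of finitely many finite values.  When \<open>p\<close> is to move, one must know that
  the cells given to \<open>q\<close> do not complete a winning chain of \<open>q\<close>; this holds because two opposite
  winning chains always cross.
\<close>

section \<open>Opposite winning chains cross\<close>

definition column :: "cell \<Rightarrow> int" where
  "column h = \<lfloor>we_pos h - of_int (row h) / 2\<rfloor>"

text \<open>The floor in \<open>column\<close> is only a cast to \<open>int\<close>: by the type
  \<open>cell\<close> its argument is already an integer.\<close>

lemma we_pos_eq: "we_pos h = of_int (column h) + of_int (row h) / 2"
proof -
  have "we_pos h - of_int (row h) / 2 \<in> \<int>"
    using Rep_cell[of h] by (auto simp: we_pos_def row_def)
  then have "of_int (column h) = we_pos h - of_int (row h) / 2"
    unfolding column_def by simp
  then show ?thesis by simp
qed

lemma cell_eqI: "column h = column h' \<Longrightarrow> row h = row h' \<Longrightarrow> h = h'"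
  using we_pos_eq[of h] we_pos_eq[of h']
  by (metis Rep_cell_inject prod.collapse row_def we_pos_def)

lemma cell_exists: "\<exists>h. column h = x \<and> row h = j"
proof -
  let ?h = "Abs_cell (of_int x + of_int j / 2, j)"
  have "Rep_cell ?h = (of_int x + of_int j / 2, j)"
    by (rule Abs_cell_inverse) simp
  then have "column ?h = x \<and> row ?h = j"
    by (simp add: column_def row_def we_pos_def)
  then show ?thesis ..
qed

lemma adjacent_cases:
  assumes "adjacent h h'"
  obtains "row h' = row h" "column h' = column h + 1"
  | "row h' = row h" "column h' = column h - 1"
  | "row h' = row h + 1" "column h' = column h"
  | "row h' = row h + 1" "column h' = column h - 1"
  | "row h' = row h - 1" "column h' = column h"
  | "row h' = row h - 1" "column h' = column h + 1"
proof -
  define x x' j j' where "x = column h" and "x' = column h'" and "j = row h" and "j' = row h'"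
  \<comment> \<open>Doubling clears the half-integers, so adjacency becomes linear arithmetic over
    \<open>int\<close>.\<close>
  have "2 * \<bar>we_pos h - we_pos h'\<bar> = of_int \<bar>(2 * x + j) - (2 * x' + j')\<bar>"
    unfolding we_pos_eq x_def x'_def j_def j'_def by (simp add: abs_if field_simps)
  then have "\<bar>we_pos h - we_pos h'\<bar> = of_int \<bar>(2 * x + j) - (2 * x' + j')\<bar> / 2"
    by simp
  then have "j = j' \<and> of_int \<bar>(2 * x + j) - (2 * x' + j')\<bar> = (of_int 2 :: rat) \<or>
      \<bar>j - j'\<bar> = 1 \<and> of_int \<bar>(2 * x + j) - (2 * x' + j')\<bar> = (of_int 1 :: rat)"
    using assms unfolding adjacent_def j_def[symmetric] j'_def[symmetric] by auto
  then have "j = j' \<and> \<bar>(2 * x + j) - (2 * x' + j')\<bar> = 2 \<or>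
      \<bar>j - j'\<bar> = 1 \<and> \<bar>(2 * x + j) - (2 * x' + j')\<bar> = 1"
    unfolding of_int_eq_iff .
  then have "j' = j \<and> (x' = x + 1 \<or> x' = x - 1) \<or> j' = j + 1 \<and> (x' = x \<or> x' = x - 1) \<or>
      j' = j - 1 \<and> (x' = x \<or> x' = x + 1)"
    by arith
  then show thesis
    using that unfolding x_def x'_def j_def j'_def by blast
qed

text \<open>
  The signed crossings of a path \<open>b\<close> with the eastward ray from \<open>v\<close>, slightly raised so that it
  runs between two rows; \<open>crossing v\<close> is the contribution of a single step.
\<close>

definition crossing :: "cell \<Rightarrow> cell \<Rightarrow> cell \<Rightarrow> int" where
  "crossing v k k' =
     (if row k = row v \<and> row k' = row v + 1 \<and> column v < column k then 1
      else if row k' = row v \<and> row k = row v + 1 \<and> column v < column k' then -1 else 0)"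

definition crossings :: "(int \<Rightarrow> cell) \<Rightarrow> int \<Rightarrow> cell \<Rightarrow> int" where
  "crossings b N v = (\<Sum>n\<in>{-N..<N}. crossing v (b n) (b (n + 1)))"

section \<open>Invariance of the crossing number\<close>

lemma sum_int_telescope:
  fixes f :: "int \<Rightarrow> 'a::ab_group_add"
  assumes "0 \<le> N"
  shows "(\<Sum>n\<in>{-N..<N}. f (n + 1) - f n) = f N - f (- N)"
proof -
  have "(\<Sum>n\<in>{-N..<-N + int k}. f (n + 1) - f n) = f (-N + int k) - f (-N)" for k
  proof (induction k)
    case (Suc k)
    have "{-N..<-N + int (Suc k)} = insert (-N + int k) {-N..<-N + int k}" by auto
    with Suc show ?case by (simp add: algebra_simps)
  qed simp
  from this[of "nat (2 * N)"] assms show ?thesis by simp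
qed

lemma crossings_row_above:
  assumes b: "\<And>n. adjacent (b n) (b (n + 1))"
    and avoid: "\<And>n. b n \<noteq> v" "\<And>n. b n \<noteq> v'"
    and v': "row v' = row v + 1" "column v' = column v \<or> column v' = column v - 1"
    and N: "0 \<le> N" "row (b N) \<noteq> row v'" "row (b (- N)) \<noteq> row v'"
  shows "crossings b N v = crossings b N v'"
proof -
  \<comment> \<open>\<open>f\<close> indicates membership in the strip between the two rays.\<close>
  define f :: "int \<Rightarrow> int"
    where "f n = (if row (b n) = row v' \<and> column v' < column (b n) then 1 else 0)" for n
  have ne: "\<not> (row (b n) = row v \<and> column (b n) = column v)"
    "\<not> (row (b n) = row v' \<and> column (b n) = column v')" for n
    using avoid cell_eqI by blast+
  have "crossing v (b n) (b (n + 1)) - crossing v' (b n) (b (n + 1)) = f (n + 1) - f n" for n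
    using b[of n] ne[of n] ne[of "n + 1"] v'
    unfolding crossing_def f_def by (elim adjacent_cases) (smt (z3))+
  then have "crossings b N v - crossings b N v' = f N - f (- N)"
    unfolding crossings_def sum_subtractf[symmetric] by (simp add: sum_int_telescope[OF N(1)])
  then show ?thesis using N by (simp add: f_def)
qed

text \<open>Within one row, a path that avoids both cells has no cell between them, so "east of"
  means the same for \<open>v\<close> and \<open>v'\<close>. Otherwise the lower cell of the two
  takes the role of \<open>v\<close> in \<open>crossings_row_above\<close>.\<close>

lemma crossings_adjacent:
  assumes b: "\<And>n. adjacent (b n) (b (n + 1))"
    and avoid: "\<And>n. b n \<noteq> v" "\<And>n. b n \<noteq> v'"
    and adj: "adjacent v v'"
    and N: "0 \<le> N" "row (b N) \<notin> {row v, row v'}" "row (b (- N)) \<notin> {row v, row v'}"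
  shows "crossings b N v = crossings b N v'"
proof -
  have ne: "\<not> (row (b n) = row v \<and> column (b n) = column v)"
    "\<not> (row (b n) = row v' \<and> column (b n) = column v')" for n
    using avoid cell_eqI by blast+
  have same_row: "crossings b N v = crossings b N v'"
    if "row v' = row v" "\<bar>column v' - column v\<bar> = 1"
    unfolding crossings_def
  proof (rule sum.cong)
    fix n
    have "column v < column (b m) \<longleftrightarrow> column v' < column (b m)" if "row (b m) = row v" for m
      using ne[of m] \<open>row v' = row v\<close> \<open>\<bar>column v' - column v\<bar> = 1\<close> that by linarith
    then show "crossing v (b n) (b (n + 1)) = crossing v' (b n) (b (n + 1))"
      unfolding crossing_def \<open>row v' = row v\<close> by auto
  qed simp
  show ?thesis
    using adj
  proof (cases rule: adjacent_cases)
    case 1 then show ?thesis by (simp add: same_row)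
  next
    case 2 then show ?thesis by (simp add: same_row)
  next
    case 3 then show ?thesis using N by (intro crossings_row_above[of b v v', OF b avoid]) auto
  next
    case 4 then show ?thesis using N by (intro crossings_row_above[of b v v', OF b avoid]) auto
  next
    case 5 then show ?thesis
      using N by (intro crossings_row_above[of b v' v, OF b avoid(2,1), symmetric]) auto
  next
    case 6 then show ?thesis
      using N by (intro crossings_row_above[of b v' v, OF b avoid(2,1), symmetric]) auto
  qed
qed

section \<open>Incompatibility of a Red and a Blue winning chain\<close>

lemma finite_cells_bounded:
  assumes "finite S"
  shows "\<exists>K\<ge>0. \<forall>h\<in>S. \<bar>column h\<bar> \<le> K \<and> \<bar>row h\<bar> \<le> K"
proof (intro exI conjI ballI)
  let ?f = "\<lambda>h. \<bar>column h\<bar> + \<bar>row h\<bar>"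
  show "0 \<le> sum ?f S" by (simp add: sum_nonneg)
  fix h assume "h \<in> S"
  then have "?f h \<le> sum ?f S" by (intro member_le_sum assms) auto
  then show "\<bar>column h\<bar> \<le> sum ?f S" "\<bar>row h\<bar> \<le> sum ?f S" by linarith+
qed

lemma int_interval_const:
  assumes "\<And>n. -M \<le> n \<Longrightarrow> n < M \<Longrightarrow> f n = f (n + 1)" "0 \<le> (M::int)"
  shows "f (- M) = f M"
proof -
  have "int k \<le> 2 * M \<Longrightarrow> f (- M) = f (- M + int k)" for k
  proof (induction k)
    case (Suc k)
    then have "f (- M + int k) = f (- M + int k + 1)" using assms(1)[of "- M + int k"] by simp
    with Suc show ?case by (simp add: algebra_simps)
  qed simp
  from this[of "nat (2 * M)"] assms(2) show ?thesis by simp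
qed

lemma winning_wrt_RedE:
  assumes "winning_wrt Red h0 r"
  obtains M where "0 \<le> M"
    "\<And>m. m \<ge> M \<Longrightarrow> we_pos (r m) > we_pos h0 \<and> row (r m) > row h0 \<and>
       we_pos (r (- m)) < we_pos h0 \<and> row (r (- m)) < row h0"
proof -
  from assms obtain M where "\<forall>m\<ge>M. we_pos (r m) > we_pos h0 \<and> row (r m) > row h0 \<and>
       we_pos (r (- m)) < we_pos h0 \<and> row (r (- m)) < row h0" by auto
  then show thesis using that[of "max 0 M"] by simp
qed

lemma winning_wrt_BlueE:
  assumes "winning_wrt Blue h0 r"
  obtains M where "0 \<le> M"
    "\<And>m. m \<ge> M \<Longrightarrow> we_pos (r m) < we_pos h0 \<and> row (r m) > row h0 \<and>
       we_pos (r (- m)) > we_pos h0 \<and> row (r (- m)) < row h0"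
proof -
  from assms obtain M where "\<forall>m\<ge>M. we_pos (r m) < we_pos h0 \<and> row (r m) > row h0 \<and>
       we_pos (r (- m)) > we_pos h0 \<and> row (r (- m)) < row h0" by auto
  then show thesis using that[of "max 0 M"] by simp
qed

text \<open>The crossing number of a long piece of \<open>b\<close> with the ray from
  \<open>r n\<close> is constant along a piece of \<open>r\<close> disjoint from \<open>b\<close>.
  Yet it is 1 at the south-west end of \<open>r\<close>, where \<open>b\<close> passes to the east,
  and 0 at the north-east end, where \<open>b\<close> passes to the west.\<close>

lemma not_both_won: "\<not> (has_won Red c \<and> has_won Blue c)"
proof
  assume "has_won Red c \<and> has_won Blue c"
  then obtain r b where r: "Z_chain Red c r" "\<And>h0. winning_wrt Red h0 r"
    and b: "Z_chain Blue c b" "\<And>h0. winning_wrt Blue h0 b"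
    unfolding has_won_def by blast
  have disj: "b m \<noteq> r n" for m n
    using r(1) b(1) unfolding Z_chain_def by (metis option.inject player.distinct(1))
  have r_adj: "adjacent (r n) (r (n + 1))" and b_adj: "adjacent (b n) (b (n + 1))" for n
    using r(1) b(1) unfolding Z_chain_def by blast+
  obtain o0 where "column o0 = 0" "row o0 = 0" using cell_exists by blast
  then have o0: "we_pos o0 = 0" "row o0 = 0" by (simp_all add: we_pos_eq)
  obtain B where "0 \<le> B" and B: "\<And>m. m \<ge> B \<Longrightarrow> we_pos (b m) < 0 \<and> row (b m) > 0 \<and>
      we_pos (b (- m)) > 0 \<and> row (b (- m)) < 0"
    using winning_wrt_BlueE[OF b(2)[of o0]] unfolding o0 by blast
  \<comment> \<open>Rows beyond \<open>K\<close> in absolute value are met only by the two tails of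
    \<open>b\<close>, whose sides are known.\<close>
  obtain K where "K \<ge> 0" and K: "\<And>n. n \<in> {-B..B} \<Longrightarrow> \<bar>row (b n)\<bar> \<le> K"
    using finite_cells_bounded[of "b ` {-B..B}"] by auto
  have b_east: "row (b n) < 0 \<and> 0 < we_pos (b n)" if "row (b n) < - K" for n
    using K[of n] B[of n] B[of "- n"] that \<open>0 \<le> K\<close> by (cases "n < -B"; cases "n > B") auto
  have b_west: "0 < row (b n) \<and> we_pos (b n) < 0" if "row (b n) > K" for n
    using K[of n] B[of n] B[of "- n"] that \<open>0 \<le> K\<close> by (cases "n < -B"; cases "n > B") auto
  \<comment> \<open>Winning with respect to these two cells pushes the ends of \<open>r\<close> into
    rows beyond \<open>K\<close> and to the proper side of the origin.\<close>
  obtain h1 h2 where h12: "column h1 = K" "row h1 = K" "column h2 = - K" "row h2 = - K"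
    using cell_exists by metis
  have pos12: "we_pos h1 \<ge> 0" "we_pos h2 \<le> 0"
    unfolding we_pos_eq h12 using \<open>K \<ge> 0\<close> by simp_all
  obtain M1 where M1: "0 \<le> M1" "\<And>m. m \<ge> M1 \<Longrightarrow> we_pos (r m) > we_pos h1 \<and> row (r m) > row h1"
    using winning_wrt_RedE[OF r(2)[of h1]] by metis
  obtain M2 where M2: "\<And>m. m \<ge> M2 \<Longrightarrow> we_pos (r (- m)) < we_pos h2 \<and> row (r (- m)) < row h2"
    using winning_wrt_RedE[OF r(2)[of h2]] by metis
  define M where "M = max M1 M2"
  have M: "0 \<le> M" "0 < we_pos (r M)" "K < row (r M)" "we_pos (r (- M)) < 0" "row (r (- M)) < - K"
    using M1(1) M1(2)[of M] M2[of M] pos12 unfolding M_def h12 by auto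
  \<comment> \<open>\<open>M\<close> is now fixed; \<open>N\<close> is chosen after it, so that the
    ends of the piece of \<open>b\<close> avoid every row of the piece of \<open>r\<close>.\<close>
  obtain L where "L \<ge> 0" and L: "\<And>n. n \<in> {-M..M} \<Longrightarrow> \<bar>row (r n)\<bar> \<le> L"
    using finite_cells_bounded[of "r ` {-M..M}"] by auto
  obtain h3 h4 where h34: "row h3 = L" "row h4 = - L"
    using cell_exists by metis
  obtain N1 where N1: "0 \<le> N1" "\<And>m. m \<ge> N1 \<Longrightarrow> row (b m) > L"
    using winning_wrt_BlueE[OF b(2)[of h3]] unfolding h34 by metis
  obtain N2 where N2: "\<And>m. m \<ge> N2 \<Longrightarrow> row (b (- m)) < - L"
    using winning_wrt_BlueE[OF b(2)[of h4]] unfolding h34 by metis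
  define N where "N = max N1 N2"
  have N: "0 \<le> N" "L < row (b N)" "row (b (- N)) < - L"
    using N1 N2[of N] unfolding N_def by auto
  have "crossings b N (r n) = crossings b N (r (n + 1))" if "-M \<le> n" "n < M" for n
    using L[of n] L[of "n + 1"] that N
    by (intro crossings_adjacent b_adj r_adj disj) auto
  then have eq: "crossings b N (r (- M)) = crossings b N (r M)"
    by (rule int_interval_const) (use M in auto)
  have "crossings b N (r M) = 0"
    unfolding crossings_def
  proof (rule sum.neutral, rule ballI)
    fix n
    have "\<not> column (r M) < column (b m)" if m: "row (b m) = row (r M)" for m
    proof -
      have "we_pos (b m) < 0" using b_west[of m] m M by simp
      with M(2) have "we_pos (b m) < we_pos (r M)" by simp
      then show ?thesis unfolding we_pos_eq m by simp
    qed
    then show "crossing (r M) (b n) (b (n + 1)) = 0" unfolding crossing_def by auto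
  qed
  moreover have "crossings b N (r (- M)) = 1"
  proof -
    \<comment> \<open>All cells of \<open>b\<close> in this row lie east of the ray's start, so
      every step over the row counts, and the sum telescopes to the change of \<open>f\<close> from
      below to above.\<close>
    define f :: "int \<Rightarrow> int" where "f n = (if row (r (- M)) < row (b n) then 1 else 0)" for n
    have east: "column (r (- M)) < column (b m)" if m: "row (b m) = row (r (- M))" for m
    proof -
      have "0 < we_pos (b m)" using b_east[of m] m M by simp
      with M(4) have "we_pos (r (- M)) < we_pos (b m)" by simp
      then show ?thesis unfolding we_pos_eq m by simp
    qed
    have "crossing (r (- M)) (b n) (b (n + 1)) = f (n + 1) - f n" for n
      using b_adj[of n] east[of n] east[of "n + 1"]
      by (elim adjacent_cases) (auto simp: crossing_def f_def)
    then have "crossings b N (r (- M)) = f N - f (- N)"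
      unfolding crossings_def by (simp add: sum_int_telescope[OF N(1)])
    moreover have "row (b (- N)) < row (r (- M))" "row (r (- M)) < row (b N)"
      using N L[of "- M"] M(1) by auto
    ultimately show ?thesis by (simp add: f_def)
  qed
  ultimately show False using eq by simp
qed

lemma not_won_opponent: "has_won p c \<Longrightarrow> \<not> has_won (opponent p) c"
  using not_both_won by (cases p) auto


section \<open>Winning within an ordinal number of moves\<close>

lemma has_won_mono:
  assumes "has_won p c" "\<And>h. c h = Some p \<Longrightarrow> c' h = Some p"
  shows "has_won p c'"
  using assms unfolding has_won_def Z_chain_def by blast

abbreviation mark :: "cell \<Rightarrow> position \<Rightarrow> position" where
  "mark h s \<equiv> \<lparr>board = (board s)(h := Some (to_move s)), to_move = opponent (to_move s)\<rparr>"

lemma mem_successors_iff: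
  "t \<in> successors s \<longleftrightarrow>
     (\<forall>p. \<not> has_won p (board s)) \<and> (\<exists>h. board s h = None \<and> t = mark h s)"
  unfolding successors_def empty_cells_def by auto

lemma opponent_simps [simp]: "opponent p \<noteq> p" "p \<noteq> opponent p" "opponent (opponent p) = p"
  by (cases p; simp)+

text \<open>Upper bounds in place of exact values: no least element or supremum has to be tracked.
  As in \<open>valuation\<close>, a position without successors is not vacuously won.\<close>

inductive wins_within :: "player \<Rightarrow> ordinal \<Rightarrow> position \<Rightarrow> bool" for p where
  won: "has_won p (board s) \<Longrightarrow> wins_within p \<alpha> s"
| own: "to_move s = p \<Longrightarrow> t \<in> successors s \<Longrightarrow> wins_within p \<beta> t \<Longrightarrow> \<beta> < \<alpha> \<Longrightarrow> wins_within p \<alpha> s"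
| opp: "to_move s \<noteq> p \<Longrightarrow> successors s \<noteq> {} \<Longrightarrow>
    (\<And>t. t \<in> successors s \<Longrightarrow> wins_within p \<alpha> t) \<Longrightarrow> wins_within p \<alpha> s"

lemma wins_within_mono: "wins_within p \<alpha> s \<Longrightarrow> \<alpha> \<le> \<beta> \<Longrightarrow> wins_within p \<beta> s"
proof (induction arbitrary: \<beta> rule: wins_within.induct)
  case (won s \<alpha>)
  then show ?case by (simp add: wins_within.won)
next
  case (own s t \<gamma> \<alpha>)
  then show ?case by (meson wins_within.own less_le_trans)
next
  case (opp s \<alpha>)
  then show ?case by (meson wins_within.opp)
qed

text \<open>A position won by anyone has no successors, which leaves only the rule
  \<open>won\<close>.\<close>

lemma wins_within_has_won:
  "wins_within p \<alpha> s \<Longrightarrow> has_won q (board s) \<Longrightarrow> has_won p (board s)"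
  by (erule wins_within.cases) (auto simp: mem_successors_iff)

lemma game_value_eq_has_value: "game_value p s = Some \<alpha> \<longleftrightarrow> has_value p \<alpha> s"
  by (rule valuation_iff_has_value[OF valuation_game_value])

lemma has_value_wins_within: "has_value p \<alpha> s \<Longrightarrow> wins_within p \<alpha> s"
proof (induction \<alpha> arbitrary: s rule: less_induct)
  case (less \<alpha>)
  \<comment> \<open>With the opponent to move, a successor may have the same value \<alpha>, out of
    reach of the induction hypothesis; the case of \<open>p\<close> to move needs only smaller
    values and so comes first.\<close>
  have own: "wins_within p \<alpha> t" if t: "has_value p \<alpha> t" "to_move t = p" for t
  proof (cases "has_won p (board t)")
    case True
    then show ?thesis by (rule wins_within.won)
  next
    case False
    then show ?thesis using t less.IH by (auto simp: has_value_own intro: wins_within.own)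
  qed
  show ?case
  proof (cases "has_won p (board s) \<or> to_move s = p")
    case True
    then show ?thesis using own less.prems wins_within.won by blast
  next
    case False
    then have nw: "\<not> has_won p (board s)" "to_move s \<noteq> p" by auto
    note hv = less.prems[unfolded has_value_opp[OF nw]]
    show ?thesis
    proof (rule wins_within.opp)
      fix t assume t: "t \<in> successors s"
      with hv obtain \<beta> where \<beta>: "\<beta> \<le> \<alpha>" "has_value p \<beta> t" by blast
      have "to_move t = p" using t nw(2) by (simp add: successors_to_move opponent_neq)
      with \<beta> have "wins_within p \<beta> t"
        using less.IH own by (cases "\<beta> = \<alpha>") auto
      then show "wins_within p \<alpha> t" using \<beta>(1) by (rule wins_within_mono)
    qed (use nw hv in auto)
  qed
qed

text \<open>With \<open>has_value_wins_within\<close>, this makes the game value the least bound for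
  \<open>wins_within\<close>.\<close>

lemma wins_within_game_value:
  "wins_within p \<alpha> s \<Longrightarrow> \<exists>\<beta>\<le>\<alpha>. game_value p s = Some \<beta>"
proof (induction rule: wins_within.induct)
  case (won s \<alpha>)
  then show ?case using valuationD(1)[OF valuation_game_value] ordinal_zero_le by blast
next
  case (own s t \<beta> \<alpha>)
  let ?V = "game_value p" and ?P = "\<lambda>\<gamma>. \<exists>t\<in>successors s. game_value p t = Some \<gamma>"
  obtain \<gamma> where \<gamma>: "\<gamma> \<le> \<beta>" "?V t = Some \<gamma>" using own by blast
  have "\<not> has_won p (board s)" using own by (simp add: mem_successors_iff)
  then have "?V s = Some (osuc (LEAST \<gamma>. ?P \<gamma>))"
    using valuationD(2)[OF valuation_game_value _ own(1)] own(2) \<gamma> by auto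
  moreover have "(LEAST \<gamma>. ?P \<gamma>) \<le> \<gamma>" using own(2) \<gamma> by (intro Least_le) blast
  then have "osuc (LEAST \<gamma>. ?P \<gamma>) \<le> \<alpha>"
    unfolding ordinal_osuc_le_iff using \<gamma>(1) own(4) by order
  ultimately show ?case by blast
next
  case (opp s \<alpha>)
  let ?A = "{\<beta>. \<exists>t\<in>successors s. game_value p t = Some \<beta>}"
  have "\<not> has_won p (board s)" using opp(2) by (auto simp: mem_successors_iff)
  moreover have "\<forall>t\<in>successors s. game_value p t \<noteq> None" using opp(4) by fastforce
  ultimately have "game_value p s = Some (osup ?A)"
    using valuationD(3)[OF valuation_game_value _ opp(1)] opp(2) by simp
  moreover have "osup ?A \<le> \<alpha>"
    using opp(4) by (intro ordinal_osup_least) fastforce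
  ultimately show ?case by blast
qed


section \<open>Giving empty cells to the opponent\<close>

text \<open>A relation, rather than \<open>assign_region\<close> itself, because the comparison must
  survive further moves on both boards.\<close>

definition filled :: "player \<Rightarrow> position \<Rightarrow> position \<Rightarrow> bool" where
  "filled q s s' \<longleftrightarrow> to_move s' = to_move s \<and>
     (\<forall>h. board s' h = board s h \<or> board s h = None \<and> board s' h = Some q)"

lemma filled_has_won:
  assumes "filled (opponent p) s s'"
  shows "has_won p (board s') \<longleftrightarrow> has_won p (board s)"
    and "has_won (opponent p) (board s) \<Longrightarrow> has_won (opponent p) (board s')"
proof -
  have "board s' h = Some p \<longleftrightarrow> board s h = Some p"
    "board s h = Some (opponent p) \<Longrightarrow> board s' h = Some (opponent p)" for h
    using assms unfolding filled_def
    by (metis opponent_simps(1) option.distinct(1) option.inject)+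
  then show "has_won p (board s') \<longleftrightarrow> has_won p (board s)"
    "has_won (opponent p) (board s) \<Longrightarrow> has_won (opponent p) (board s')"
    using has_won_mono by metis+
qed

text \<open>Additional cells of the opponent never help \<open>p\<close>: each winning move of
  \<open>p\<close> on the fuller board is also available on the emptier one.\<close>

lemma wins_within_filled:
  "wins_within p \<alpha> s' \<Longrightarrow> filled (opponent p) s s' \<Longrightarrow> wins_within p \<alpha> s"
proof (induction arbitrary: s rule: wins_within.induct)
  case (won s' \<alpha>)
  then show ?case using filled_has_won(1) wins_within.won by blast
next
  case (own s' t' \<beta> \<alpha>)
  from own(2) obtain h where h: "board s' h = None" "t' = mark h s'"
    and nw: "\<forall>q. \<not> has_won q (board s')" by (auto simp: mem_successors_iff)
  have "board s h = None" using h(1) own.prems unfolding filled_def by metis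
  moreover have "\<forall>q. \<not> has_won q (board s)"
    using nw filled_has_won[OF own.prems] opponent_neq by metis
  ultimately have "mark h s \<in> successors s" by (auto simp: mem_successors_iff)
  moreover have "filled (opponent p) (mark h s) t'"
    using own.prems h unfolding filled_def by auto
  then have "wins_within p \<beta> (mark h s)" by (rule own.IH)
  moreover have "to_move s = p" using own unfolding filled_def by simp
  ultimately show ?case using own(4) by (blast intro: wins_within.own)
next
  case (opp s' \<alpha>)
  have mv: "to_move s' = opponent p" "to_move s = opponent p"
    using opponent_neq[OF opp(1)[symmetric]] opp.prems by (simp_all add: filled_def)
  \<comment> \<open>\<open>h'\<close> shows that \<open>s\<close> has a successor too, and serves as
    the spare move below.\<close>
  from opp(2) obtain h' where h': "board s' h' = None"
    and nw': "\<forall>q. \<not> has_won q (board s')" by (auto simp: mem_successors_iff)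
  have nw: "\<forall>q. \<not> has_won q (board s)"
    using nw' filled_has_won[OF opp.prems] opponent_neq by metis
  have "board s h' = None" using h' opp.prems unfolding filled_def by metis
  then have "mark h' s \<in> successors s" using nw by (auto simp: mem_successors_iff)
  moreover have "wins_within p \<alpha> t" if "t \<in> successors s" for t
  proof -
    from that obtain h where h: "board s h = None" "t = mark h s"
      by (auto simp: mem_successors_iff)
    \<comment> \<open>If \<open>h\<close> was already given away, compare with a spare move of the opponent instead.\<close>
    define k where "k = (if board s' h = None then h else h')"
    have k: "board s' k = None" using h' by (simp add: k_def)
    then have "mark k s' \<in> successors s'" using nw' by (auto simp: mem_successors_iff)
    moreover have "filled (opponent p) t (mark k s')"
    proof -
      have f: "board s' y = board s y \<or> board s y = None \<and> board s' y = Some (opponent p)" for y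
        using opp.prems unfolding filled_def by blast
      show ?thesis
      proof (cases "board s' h = None")
        case True
        then show ?thesis using f by (simp add: filled_def k_def h mv)
      next
        case False
        then have "board s' h = Some (opponent p)" "board s h' = None" "k = h'"
          using f[of h] f[of h'] h h' k_def by auto
        then show ?thesis using f by (simp add: filled_def h mv)
      qed
    qed
    ultimately show ?thesis using opp.IH by blast
  qed
  moreover have "to_move s \<noteq> p" using mv(2) by simp
  ultimately show ?case by (blast intro: wins_within.opp)
qed

section \<open>Reduction to finitely many open cells\<close>

lemma assign_region_simps [simp]:
  "to_move (assign_region q R s) = to_move s"
  "board (assign_region q R s) h = (if h \<in> R \<and> board s h = None then Some q else board s h)"
  by (simp_all add: assign_region_def empty_cells_def)

lemma filled_assign_region: "filled q s (assign_region q R s)"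
  by (simp add: filled_def)

abbreviation fin_ord :: "nat \<Rightarrow> ordinal" where
  "fin_ord n \<equiv> (osuc ^^ n) 0"

text \<open>\<open>F\<close> is the set of cells left open. Keeping
  \<open>fin_ord n \<le> \<alpha>\<close> in the conclusion lets the final theorem squeeze \<alpha>
  between equal bounds.\<close>

lemma wins_within_local:
  assumes "wins_within p \<alpha> s"
  shows "\<exists>F n. finite F \<and> fin_ord n \<le> \<alpha> \<and>
    wins_within p (fin_ord n) (assign_region (opponent p) (- F) s)"
  using assms
proof (induction rule: wins_within.induct)
  case (won s \<alpha>)
  then have "wins_within p (fin_ord 0) (assign_region (opponent p) (- {}) s)"
    using filled_has_won(1)[OF filled_assign_region] by (blast intro: wins_within.won)
  then show ?case by (metis finite.emptyI funpow_0 ordinal_zero_le)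
next
  case (own s t \<beta> \<alpha>)
  let ?q = "opponent p"
  from own(2) obtain h where h: "board s h = None" "t = mark h s"
    and nw: "\<forall>q. \<not> has_won q (board s)" by (auto simp: mem_successors_iff)
  from own.IH obtain F n where F: "finite F" and n: "fin_ord n \<le> \<beta>"
    and wt: "wins_within p (fin_ord n) (assign_region ?q (- F) t)" by blast
  \<comment> \<open>The winning move \<open>h\<close> must stay open as well; after it is played,
    the board agrees with the one from the induction hypothesis.\<close>
  define s' where "s' = assign_region ?q (- insert h F) s"
  have fill: "filled ?q (mark h s') (assign_region ?q (- F) t)"
    using own(1) h by (auto simp: filled_def s'_def)
  have s'h: "board s' h = None" using h by (simp add: s'_def)
  have "\<not> has_won p (board s')"
    using nw filled_has_won(1)[OF filled_assign_region] unfolding s'_def by blast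
  \<comment> \<open>A chain of \<open>?q\<close> completed by the gift would survive the move
    \<open>h\<close>; but there \<open>p\<close> would have to have won too, and opposite winning
    chains cross.\<close>
  moreover have "\<not> has_won ?q (board s')"
  proof
    assume "has_won ?q (board s')"
    then have "has_won ?q (board (mark h s'))"
      by (rule has_won_mono) (use s'h in auto)
    then have won: "has_won ?q (board (assign_region ?q (- F) t))"
      using filled_has_won(2)[OF fill] by blast
    with wins_within_has_won[OF wt] not_won_opponent show False by blast
  qed
  ultimately have "mark h s' \<in> successors s'"
    using s'h opponent_neq unfolding mem_successors_iff by metis
  moreover have "to_move s' = p" using own(1) by (simp add: s'_def)
  moreover have "wins_within p (fin_ord n) (mark h s')"
    using wt fill by (rule wins_within_filled)
  ultimately have "wins_within p (fin_ord (Suc n)) s'"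
    by (auto intro: wins_within.own ordinal_lt_osuc)
  moreover have "fin_ord (Suc n) \<le> \<alpha>"
    using n own(4) by (auto simp: ordinal_osuc_le_iff)
  ultimately show ?case using F unfolding s'_def by blast
next
  case (opp s \<alpha>)
  let ?q = "opponent p"
  have mv: "to_move s = ?q" using opponent_neq[OF opp(1)[symmetric]] by simp
  from opp(2) obtain h0 where h0: "board s h0 = None"
    and nw: "\<forall>q. \<not> has_won q (board s)" by (auto simp: mem_successors_iff)
  have "\<exists>F n. finite F \<and> fin_ord n \<le> \<alpha> \<and>
      wins_within p (fin_ord n) (assign_region ?q (- F) (mark h s))" if "board s h = None" for h
    using opp.IH[of "mark h s"] that nw by (auto simp: mem_successors_iff)
  then obtain F n where F: "\<And>h. board s h = None \<Longrightarrow> finite (F h)"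
    and n: "\<And>h. board s h = None \<Longrightarrow> fin_ord (n h) \<le> \<alpha>"
    and w: "\<And>h. board s h = None \<Longrightarrow>
      wins_within p (fin_ord (n h)) (assign_region ?q (- F h) (mark h s))"
    by metis
  \<comment> \<open>\<open>H\<close> holds the moves that need their own answer; any other move lies
    outside \<open>F h0\<close>, where the answer to \<open>h0\<close> already concedes it.\<close>
  define H where "H = insert h0 {h \<in> F h0. board s h = None}"
  define G where "G = F h0 \<union> H \<union> (\<Union>h\<in>H. F h)"
  define s' where "s' = assign_region ?q (- G) s"
  have H: "finite H" "\<And>h. h \<in> H \<Longrightarrow> board s h = None"
    using F[OF h0] h0 by (auto simp: H_def)
  have "finite G" using H F h0 by (auto simp: G_def)
  obtain m where m: "m \<in> H" "\<And>h. h \<in> H \<Longrightarrow> fin_ord (n h) \<le> fin_ord (n m)"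
  proof -
    have "finite ((\<lambda>h. fin_ord (n h)) ` H)" "(\<lambda>h. fin_ord (n h)) ` H \<noteq> {}"
      using H(1) by (auto simp: H_def)
    then show thesis using Max_in Max_ge that by (metis (no_types, lifting) image_iff imageI)
  qed
  have s'h0: "board s' h0 = None" using h0 by (simp add: s'_def G_def H_def)
  have nwp: "\<not> has_won p (board s')"
    using nw filled_has_won(1)[OF filled_assign_region] unfolding s'_def by blast
  have nwq: "\<not> has_won ?q (board s')"
  proof
    assume "has_won ?q (board s')"
    then have "has_won ?q (board (assign_region ?q (- F h0) (mark h0 s)))"
      by (rule has_won_mono) (use mv in \<open>auto simp: s'_def G_def H_def split: if_splits\<close>)
    then have "has_won p (board (assign_region ?q (- F h0) (mark h0 s)))"
      by (rule wins_within_has_won[OF w[OF h0]])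
    then have "has_won p (board s)"
      by (rule has_won_mono) (use mv in \<open>auto split: if_splits\<close>)
    with nw show False by blast
  qed
  have "wins_within p (fin_ord (n m)) s'"
  proof (rule wins_within.opp)
    show "to_move s' \<noteq> p" using mv by (simp add: s'_def)
    have "\<not> has_won q (board s')" for q
      using nwp nwq opponent_neq[of p q] by (cases "p = q") auto
    then have "mark h0 s' \<in> successors s'"
      using s'h0 by (auto simp: mem_successors_iff)
    then show "successors s' \<noteq> {}" by blast
  next
    fix t assume "t \<in> successors s'"
    then obtain h where h: "board s' h = None" and t: "t = mark h s'"
      by (auto simp: mem_successors_iff)
    have sh: "board s h = None" using h by (auto simp: s'_def split: if_splits)
    \<comment> \<open>\<open>k\<close> is the move whose answer is reused against \<open>h\<close>:
      if \<open>h\<close> is not in \<open>H\<close>, the filled board after \<open>h0\<close>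
      already gives \<open>h\<close> to the opponent.\<close>
    define k where "k = (if h \<in> H then h else h0)"
    have k: "k \<in> H" by (simp add: k_def H_def)
    have "F k \<subseteq> G" using k by (auto simp: G_def)
    moreover have "h \<notin> F k" if "h \<noteq> k"
      using that sh by (auto simp: k_def H_def split: if_splits)
    ultimately have "filled ?q t (assign_region ?q (- F k) (mark k s))"
      using sh mv H(2)[OF k] by (auto simp: filled_def t s'_def)
    then have "wins_within p (fin_ord (n k)) t"
      by (rule wins_within_filled[OF w[OF H(2)[OF k]]])
    then show "wins_within p (fin_ord (n m)) t"
      using m(2)[OF k] by (rule wins_within_mono)
  qed
  then show ?case using \<open>finite G\<close> n[OF H(2)[OF m(1)]] unfolding s'_def by blast
qed

theorem theorem2p39:
  fixes p :: player and s :: position and \<alpha> :: ordinal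
  assumes "game_value p s = Some \<alpha>"
  shows "essentially_local p s \<and> finite_ordinal \<alpha>"
proof -
  have "wins_within p \<alpha> s"
    using assms by (simp add: game_value_eq_has_value has_value_wins_within)
  then obtain F n where F: "finite F" and n: "fin_ord n \<le> \<alpha>"
    and w: "wins_within p (fin_ord n) (assign_region (opponent p) (- F) s)" (is "wins_within p _ ?s")
    using wins_within_local by blast
  obtain \<beta> where \<beta>: "\<beta> \<le> fin_ord n" "game_value p ?s = Some \<beta>"
    using wins_within_game_value[OF w] by blast
  \<comment> \<open>Taking the gift back bounds the value of \<open>s\<close> by \<beta>, which
    closes the cycle \<open>\<alpha> \<le> \<beta> \<le> fin_ord n \<le> \<alpha>\<close>.\<close>
  have "wins_within p \<beta> s"
    using \<beta>(2) has_value_wins_within wins_within_filled[OF _ filled_assign_region]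
    unfolding game_value_eq_has_value by blast
  then have "\<alpha> \<le> \<beta>"
    using wins_within_game_value assms by fastforce
  with \<beta> n have eq: "\<beta> = \<alpha>" "\<alpha> = fin_ord n" by order+
  have "dead_region p s (- F)"
    using assms \<beta>(2) eq(1) by (simp add: dead_region_def)
  moreover have "finite (empty_cells s - - F)" using F by simp
  ultimately show ?thesis
    using eq(2) unfolding essentially_local_def finite_ordinal_def by blast
qed

end
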